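(* Let $\nu,d\in\mathbb{C}$ with $\nu\ne 0$, $d\ne 0$ and $|\nu|\le 1$, let $\Phi(z)=\nu z+d$, and let $\Upsilon$ be an entire function on $\mathbb{C}$ such that the weighted composition operator $C_{\Upsilon,\Phi}$ is bounded on $H_E(\zeta)$. If $C_{\Upsilon,\Phi}$ is self-adjoint, then $$\Upsilon(z)=\alpha K_{\Phi(0)}(z)\quad\text{for all } z\in\mathbb{C},\quad\text{where }\alpha=\zeta_0^2\,\overline{\Upsilon(0)}\text{ is a real number},$$ and, according to the value of $\Upsilon(0)$, the corresponding one of the following is true: (i) if $\Upsilon(0)=0$, then $\Upsilon\equiv 0$, and consequently $C_{\Upsilon,\Phi}\equiv 0$; (ii) if $\Upsilon(0)\ne 0$, then $\nu$ is a real number.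
   Context: Let $\mathbb{N}_0=\mathbb{N}\cup\{0\}$ and let $\zeta=(\zeta_n)_{n\in\mathbb{N}_0}$ be a sequence of positive real numbers with $\lim_{n\to\infty}\zeta_n^{1/n}=\infty$. The weighted Hardy space of entire functions induced by $\zeta$ is the Hilbert space $H_E(\zeta)=\{g(z)=\sum_{n=0}^\infty b_nz^n : \|g\|^2=\sum_{n=0}^\infty |b_n|^2\zeta_n^2<\infty\}$ of entire functions on $\mathbb{C}$, with inner product $\langle g,h\rangle=\sum_{n=0}^\infty b_n\overline{c_n}\zeta_n^2$ for $g(z)=\sum b_nz^n$ and $h(z)=\sum c_nz^n$ in $H_E(\zeta)$. For $p\in\mathbb{C}$, the reproducing kernel is $K_p(w)=\sum_{n=0}^\infty \frac{1}{\zeta_n^2}\overline{p}^{\,n}w^n$ for $w\in\mathbb{C}$, which satisfies $f(p)=\langle f,K_p\rangle$ for all $f\in H_E(\zeta)$. For entire functions $\Upsilon,\Phi:\mathbb{C}\to\mathbb{C}$, the weighted composition operator is $C_{\Upsilon,\Phi}f=\Upsilon\cdot(f\circ\Phi)$; it is bounded on $H_E(\zeta)$ if it maps $H_E(\zeta)$ into itself as a bounded linear operator. *)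

theory Defs
  imports "HOL-Complex_Analysis.Complex_Analysis"
begin

text \<open>
  The coefficient \<open>b\<^sub>n\<close> of an entire function is its \<open>n\<close>-th Taylor coefficient at 0.
  Every entire function is the everywhere convergent sum of its Taylor series
  (\<open>holomorphic_iff_power_series\<close>), so no separate convergence condition is needed below.
\<close>

definition taylor_coeff :: "(complex \<Rightarrow> complex) \<Rightarrow> nat \<Rightarrow> complex" where
  "taylor_coeff f n = fps_nth (fps_expansion f 0) n"

definition hardy_weight :: "(nat \<Rightarrow> real) \<Rightarrow> bool" where
  "hardy_weight \<zeta> \<longleftrightarrow> (\<forall>n. \<zeta> n > 0) \<and> filterlim (\<lambda>n. root n (\<zeta> n)) at_top sequentially"

definition hardy_space :: "(nat \<Rightarrow> real) \<Rightarrow> (complex \<Rightarrow> complex) set" where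
  "hardy_space \<zeta> =
     {f. f holomorphic_on UNIV \<and> summable (\<lambda>n. (cmod (taylor_coeff f n))\<^sup>2 * (\<zeta> n)\<^sup>2)}"

text \<open>
  The two series below converge for members of \<^const>\<open>hardy_space\<close>; outside that space the
  values carry no meaning.
\<close>

definition hardy_inner ::
    "(nat \<Rightarrow> real) \<Rightarrow> (complex \<Rightarrow> complex) \<Rightarrow> (complex \<Rightarrow> complex) \<Rightarrow> complex" where
  "hardy_inner \<zeta> f g =
     (\<Sum>n. taylor_coeff f n * cnj (taylor_coeff g n) * complex_of_real ((\<zeta> n)\<^sup>2))"

definition hardy_norm :: "(nat \<Rightarrow> real) \<Rightarrow> (complex \<Rightarrow> complex) \<Rightarrow> real" where
  "hardy_norm \<zeta> f = sqrt (\<Sum>n. (cmod (taylor_coeff f n))\<^sup>2 * (\<zeta> n)\<^sup>2)"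

definition hardy_kernel :: "(nat \<Rightarrow> real) \<Rightarrow> complex \<Rightarrow> complex \<Rightarrow> complex" where
  "hardy_kernel \<zeta> p w = (\<Sum>n. complex_of_real (1 / (\<zeta> n)\<^sup>2) * cnj p ^ n * w ^ n)"

definition weighted_comp ::
    "(complex \<Rightarrow> complex) \<Rightarrow> (complex \<Rightarrow> complex) \<Rightarrow> (complex \<Rightarrow> complex) \<Rightarrow> complex \<Rightarrow> complex" where
  "weighted_comp \<Upsilon> \<Phi> f = (\<lambda>z. \<Upsilon> z * (f \<circ> \<Phi>) z)"

text \<open>
  The Hilbert space is a set of functions, not a type, so operators are functions on
  \<^typ>\<open>complex \<Rightarrow> complex\<close> of which only the restriction to \<^const>\<open>hardy_space\<close> matters.
\<close>

definition hardy_bounded_op ::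
    "(nat \<Rightarrow> real) \<Rightarrow> ((complex \<Rightarrow> complex) \<Rightarrow> complex \<Rightarrow> complex) \<Rightarrow> bool" where
  "hardy_bounded_op \<zeta> T \<longleftrightarrow>
     T ` hardy_space \<zeta> \<subseteq> hardy_space \<zeta> \<and>
     (\<forall>f\<in>hardy_space \<zeta>. \<forall>g\<in>hardy_space \<zeta>. T (\<lambda>z. f z + g z) = (\<lambda>z. T f z + T g z)) \<and>
     (\<forall>c. \<forall>f\<in>hardy_space \<zeta>. T (\<lambda>z. c * f z) = (\<lambda>z. c * T f z)) \<and>
     (\<exists>M. \<forall>f\<in>hardy_space \<zeta>. hardy_norm \<zeta> (T f) \<le> M * hardy_norm \<zeta> f)"

text \<open>
  \<open>S\<close> is the Hilbert space adjoint of \<open>T\<close>. It is unique on \<^const>\<open>hardy_space\<close>, so stating it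
  as a relation avoids a choice operator.
\<close>

definition hardy_adjoint ::
    "(nat \<Rightarrow> real) \<Rightarrow> ((complex \<Rightarrow> complex) \<Rightarrow> complex \<Rightarrow> complex)
       \<Rightarrow> ((complex \<Rightarrow> complex) \<Rightarrow> complex \<Rightarrow> complex) \<Rightarrow> bool" where
  "hardy_adjoint \<zeta> T S \<longleftrightarrow>
     hardy_bounded_op \<zeta> S \<and>
     (\<forall>f\<in>hardy_space \<zeta>. \<forall>g\<in>hardy_space \<zeta>. hardy_inner \<zeta> (T f) g = hardy_inner \<zeta> f (S g))"

definition hardy_self_adjoint ::
    "(nat \<Rightarrow> real) \<Rightarrow> ((complex \<Rightarrow> complex) \<Rightarrow> complex \<Rightarrow> complex) \<Rightarrow> bool" where
  "hardy_self_adjoint \<zeta> T \<longleftrightarrow> hardy_adjoint \<zeta> T T"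

end

theory Submission
  imports Defs
begin

text \<open>
  Testing self-adjointness on the pairs \<open>(1, z\<^sup>m)\<close> determines every Taylor coefficient of \<open>\<Upsilon>\<close>,
  and the pair \<open>(z, z)\<close> gives that \<open>\<Upsilon>(0) \<nu>\<close> is real.
\<close>

lemma taylor_coeff_eq_fps_nth:
  assumes "f has_fps_expansion F"
  shows "taylor_coeff f n = fps_nth F n"
  using assms by (simp add: taylor_coeff_def fps_expansion_eqI)

lemma has_fps_expansion_taylor:
  assumes "f holomorphic_on UNIV"
  shows "f has_fps_expansion fps_expansion f 0"
  using assms by (intro has_fps_expansion_fps_expansion[of UNIV]) auto

lemma taylor_coeff_0: "taylor_coeff f 0 = f 0"
  by (simp add: taylor_coeff_def fps_expansion_def)

lemma taylor_coeff_power: "taylor_coeff (\<lambda>z. z ^ m) n = (if n = m then 1 else 0)"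
proof -
  have "(\<lambda>z. z ^ m :: complex) has_fps_expansion fps_X ^ m"
    by (intro fps_expansion_intros)
  from taylor_coeff_eq_fps_nth[OF this] show ?thesis
    by (simp add: fps_X_power_iff)
qed

text \<open>Every \<open>z\<close> lies in the disc of radius \<open>norm z + 1\<close> about 0, so
  the Taylor expansion on that disc already applies at \<open>z\<close>.\<close>

lemma entire_taylor_sums:
  assumes "f holomorphic_on UNIV"
  shows "(\<lambda>n. taylor_coeff f n * z ^ n) sums f z"
proof -
  have "f holomorphic_on ball 0 (norm z + 1)"
    using assms by (rule holomorphic_on_subset) simp
  from holomorphic_power_series[OF this, of z] show ?thesis
    by (simp add: taylor_coeff_def fps_expansion_def)
qed

lemma power_in_hardy_space: "(\<lambda>z. z ^ m) \<in> hardy_space \<zeta>"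
proof -
  have "summable (\<lambda>n. (cmod (taylor_coeff (\<lambda>z. z ^ m) n))\<^sup>2 * (\<zeta> n)\<^sup>2)"
    by (rule summable_finite[of "{m}"]) (auto simp: taylor_coeff_power)
  then show ?thesis
    by (auto simp: hardy_space_def intro!: holomorphic_intros)
qed

lemma hardy_inner_power_right:
  "hardy_inner \<zeta> f (\<lambda>z. z ^ m) = taylor_coeff f m * complex_of_real ((\<zeta> m)\<^sup>2)"
  unfolding hardy_inner_def
  by (subst suminf_finite[of "{m}"]) (auto simp: taylor_coeff_power)

lemma hardy_inner_power_left:
  "hardy_inner \<zeta> (\<lambda>z. z ^ m) f = cnj (taylor_coeff f m) * complex_of_real ((\<zeta> m)\<^sup>2)"
  unfolding hardy_inner_def
  by (subst suminf_finite[of "{m}"]) (auto simp: taylor_coeff_power)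

text \<open>Distinct monomials are orthogonal, so pairing with one isolates a single weighted Taylor
  coefficient. Self-adjointness on \<open>z ^ k\<close> and \<open>z ^ m\<close> therefore says that
  the matrix of \<open>T\<close> on monomials is Hermitian up to the weights.\<close>

lemma self_adjoint_taylor_coeff_power:
  assumes "hardy_self_adjoint \<zeta> T"
  shows "taylor_coeff (T (\<lambda>z. z ^ k)) m * complex_of_real ((\<zeta> m)\<^sup>2) =
         cnj (taylor_coeff (T (\<lambda>z. z ^ m)) k) * complex_of_real ((\<zeta> k)\<^sup>2)"
  using assms power_in_hardy_space
  unfolding hardy_self_adjoint_def hardy_adjoint_def
  by (metis hardy_inner_power_left hardy_inner_power_right)

text \<open>With \<open>\<Upsilon>\<close> for \<open>f\<close>, \<open>\<nu>\<close> for
  \<open>a\<close> and \<open>d\<close> for \<open>b\<close>, this computes the diagonal matrix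
  entry of the operator at the monomial \<open>z\<close>, which is where \<open>\<nu>\<close>
  enters.\<close>

lemma taylor_coeff_1_mult_affine:
  assumes "f holomorphic_on UNIV"
  shows "taylor_coeff (\<lambda>z. f z * (a * z + b)) 1 = taylor_coeff f 0 * a + taylor_coeff f 1 * b"
proof -
  have "(\<lambda>z. f z * (a * z + b)) has_fps_expansion
          fps_expansion f 0 * (fps_const a * fps_X + fps_const b)"
    by (intro fps_expansion_intros has_fps_expansion_taylor assms)
  from taylor_coeff_eq_fps_nth[OF this] show ?thesis
    by (simp add: taylor_coeff_def fps_mult_nth)
qed

theorem theorem2p5:
  fixes \<zeta> :: "nat \<Rightarrow> real" and \<nu> d :: complex and \<Phi> \<Upsilon> :: "complex \<Rightarrow> complex"
  assumes "hardy_weight \<zeta>"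
    and "\<nu> \<noteq> 0" and "d \<noteq> 0" and "cmod \<nu> \<le> 1"
    and "\<Phi> = (\<lambda>z. \<nu> * z + d)"
    and "\<Upsilon> holomorphic_on UNIV"
    and "hardy_bounded_op \<zeta> (weighted_comp \<Upsilon> \<Phi>)"
    and "hardy_self_adjoint \<zeta> (weighted_comp \<Upsilon> \<Phi>)"
  shows "(let \<alpha> = complex_of_real ((\<zeta> 0)\<^sup>2) * cnj (\<Upsilon> 0)
          in \<alpha> \<in> \<real> \<and> (\<forall>z. \<Upsilon> z = \<alpha> * hardy_kernel \<zeta> (\<Phi> 0) z))
       \<and> (\<Upsilon> 0 = 0 \<longrightarrow>
            (\<forall>z. \<Upsilon> z = 0) \<and> (\<forall>f\<in>hardy_space \<zeta>. \<forall>z. weighted_comp \<Upsilon> \<Phi> f z = 0))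
       \<and> (\<Upsilon> 0 \<noteq> 0 \<longrightarrow> \<nu> \<in> \<real>)"
proof -
  define \<alpha> where "\<alpha> = complex_of_real ((\<zeta> 0)\<^sup>2) * cnj (\<Upsilon> 0)"
  have pos: "\<zeta> n > 0" for n
    using assms(1) by (simp add: hardy_weight_def)
  have T_power: "weighted_comp \<Upsilon> \<Phi> (\<lambda>z. z ^ m) = (\<lambda>z. \<Upsilon> z * (\<nu> * z + d) ^ m)" for m
    by (simp add: weighted_comp_def assms(5))
  note sa = self_adjoint_taylor_coeff_power[OF assms(8), unfolded T_power]
  \<comment> \<open>The operator sends the constant 1 to \<open>\<Upsilon>\<close>, and the zeroth
    coefficient of the image of \<open>z ^ m\<close> is its value
    \<open>\<Upsilon> 0 * d ^ m\<close> at 0.\<close>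
  have coeff_mult: "taylor_coeff \<Upsilon> m * complex_of_real ((\<zeta> m)\<^sup>2) = \<alpha> * cnj d ^ m" for m
    using sa[of 0 m] by (simp add: taylor_coeff_0 \<alpha>_def)
  then have coeff: "taylor_coeff \<Upsilon> m = \<alpha> * (complex_of_real (1 / (\<zeta> m)\<^sup>2) * cnj d ^ m)" for m
    using pos[of m] by (simp add: field_simps)
  \<comment> \<open>For \<open>m = 0\<close> the relation equates \<open>\<Upsilon> 0\<close> and
    its conjugate after cancelling the positive weight.\<close>
  have \<Upsilon>0_real: "\<Upsilon> 0 \<in> \<real>"
    using coeff_mult[of 0] pos[of 0] by (simp add: \<alpha>_def taylor_coeff_0 Reals_cnj_iff)
  \<comment> \<open>If \<open>\<alpha> = 0\<close>, all Taylor coefficients of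
    \<open>\<Upsilon>\<close> vanish and both sides are 0. Otherwise dividing the Taylor series of
    \<open>\<Upsilon>\<close> by \<open>\<alpha>\<close> yields both the convergence of the kernel
    series at \<open>\<Phi> 0 = d\<close> and its sum.\<close>
  have \<Upsilon>_eq: "\<Upsilon> z = \<alpha> * hardy_kernel \<zeta> (\<Phi> 0) z" for z
  proof (cases "\<alpha> = 0")
    case True
    then show ?thesis
      using sums_unique[OF entire_taylor_sums[OF assms(6), of z]] by (simp add: coeff)
  next
    case False
    have "(\<lambda>n. \<alpha> * (complex_of_real (1 / (\<zeta> n)\<^sup>2) * cnj d ^ n * z ^ n)) sums \<Upsilon> z"
      using entire_taylor_sums[OF assms(6), of z] by (simp add: coeff mult.assoc)
    from sums_divide[OF this, of \<alpha>] False
    have "(\<lambda>n. complex_of_real (1 / (\<zeta> n)\<^sup>2) * cnj d ^ n * z ^ n) sums (\<Upsilon> z / \<alpha>)"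
      by simp
    then have "\<Upsilon> z / \<alpha> = hardy_kernel \<zeta> (\<Phi> 0) z"
      using sums_unique by (fastforce simp: hardy_kernel_def assms(5))
    with False show ?thesis
      by (metis mult.commute nonzero_divide_eq_eq)
  qed
  have "\<nu> \<in> \<real>" if "\<Upsilon> 0 \<noteq> 0"
  proof -
    define c where "c = taylor_coeff (\<lambda>z. \<Upsilon> z * (\<nu> * z + d)) 1"
    \<comment> \<open>A diagonal entry of a Hermitian matrix is real: here the weights on both sides
      are the same and cancel.\<close>
    have "c \<in> \<real>"
      using sa[of 1 1] pos[of 1] by (simp add: c_def Reals_cnj_iff)
    moreover have "c = \<Upsilon> 0 * \<nu> + taylor_coeff \<Upsilon> 1 * d"
      unfolding c_def by (simp only: taylor_coeff_1_mult_affine[OF assms(6)] taylor_coeff_0)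
    \<comment> \<open>By the coefficient formula this product is \<open>\<alpha>\<close> times
      \<open>d * cnj d = |d|^2\<close> over \<open>(\<zeta> 1)^2\<close>, and
      \<open>\<alpha>\<close> is a real multiple of the real number
      \<open>cnj (\<Upsilon> 0)\<close>.\<close>
    moreover have "taylor_coeff \<Upsilon> 1 * d \<in> \<real>"
      using \<Upsilon>0_real by (simp add: coeff \<alpha>_def Reals_cnj_iff mult_ac)
    ultimately have "\<Upsilon> 0 * \<nu> \<in> \<real>"
      by (metis Reals_diff add_diff_cancel_right')
    from Reals_divide[OF this \<Upsilon>0_real] that show ?thesis
      by simp
  qed
  moreover have "\<alpha> \<in> \<real>"
    using \<Upsilon>0_real by (simp add: \<alpha>_def Reals_cnj_iff)
  moreover have "\<Upsilon> z = 0" if "\<Upsilon> 0 = 0" for z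
    using \<Upsilon>_eq[of z] that by (simp add: \<alpha>_def)
  ultimately show ?thesis
    using \<Upsilon>_eq unfolding Let_def \<alpha>_def[symmetric] weighted_comp_def
    by (metis mult_zero_left)
qed

end
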